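(* Let $A \subset \mathbb{R}^n$ be a set of points (not necessarily finite) and let $\sigma = [a_0 a_1 \ldots a_p]$, $p\ge 0$, be a simplex with vertices in $A$. Then $\sigma$ has a strong witness in $\mathbb{R}^n$ with respect to $A$ if and only if every subsimplex $\tau \leq \sigma$ has a weak witness in $\mathbb{R}^n$ with respect to $A$.
   Context: A $p$-simplex $\sigma=[a_0a_1\ldots a_p]$ with vertices in $A$ is an abstract simplex, i.e. a set of $p+1$ distinct points $\{a_0,\ldots,a_p\}\subseteq A$ (no affine independence or bound on $p$ is assumed). A subsimplex $\tau\le\sigma$ is a simplex whose vertex set is a nonempty subset of that of $\sigma$ (including $\sigma$ itself). Let $|\cdot|$ be the Euclidean norm. A point $x\in\mathbb{R}^n$ is a weak witness for $\sigma$ with respect to $A$ if $|x-a|\le|x-b|$ whenever $a\in\{a_0,\ldots,a_p\}$ and $b\in A\setminus\{a_0,\ldots,a_p\}$. A point $x\in\mathbb{R}^n$ is a strong witness for $\sigma$ with respect to $A$ if it is a weak witness for $\sigma$ with respect to $A$ and additionally $|x-a_0|=|x-a_1|=\cdots=|x-a_p|$. *)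

theory Defs
  imports "HOL-Analysis.Analysis"
begin

text \<open>
  A simplex is represented by its set of vertices. In contrast to the library's
  geometric \<open>simplex\<close>, the vertices need not be affinely independent and
  \<open>p\<close> is not bounded by the dimension.
\<close>

definition abstract_simplex :: "'a set \<Rightarrow> nat \<Rightarrow> 'a set \<Rightarrow> bool"
  where "abstract_simplex A p \<sigma> \<longleftrightarrow> finite \<sigma> \<and> card \<sigma> = p + 1 \<and> \<sigma> \<subseteq> A"

definition subsimplex :: "'a set \<Rightarrow> 'a set \<Rightarrow> bool"
  where "subsimplex \<tau> \<sigma> \<longleftrightarrow> \<tau> \<noteq> {} \<and> \<tau> \<subseteq> \<sigma>"

definition weak_witness :: "'a::real_normed_vector set \<Rightarrow> 'a set \<Rightarrow> 'a \<Rightarrow> bool"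
  where "weak_witness A \<sigma> x \<longleftrightarrow> (\<forall>a\<in>\<sigma>. \<forall>b\<in>A - \<sigma>. norm (x - a) \<le> norm (x - b))"

definition strong_witness :: "'a::real_normed_vector set \<Rightarrow> 'a set \<Rightarrow> 'a \<Rightarrow> bool"
  where "strong_witness A \<sigma> x \<longleftrightarrow>
    weak_witness A \<sigma> x \<and> (\<forall>a\<in>\<sigma>. \<forall>a'\<in>\<sigma>. norm (x - a) = norm (x - a'))"

end

theory Submission
  imports Defs
begin

text \<open>
  Up to the common term \<open>x \<bullet> x\<close>, the squared distance from \<open>x\<close> to \<open>a\<close> is affine in \<open>x\<close>, so comparing it
  with a level is a linear condition on the pair (point, level). A weak witness for \<open>P\<close> yields a
  pair with \<open>P\<close> below the level and \<open>A - P\<close> above it. If a vertex \<open>q\<close> lies below the level for one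
  pair and above it for another, some pair on the segment between them has \<open>q\<close> exactly at the
  level, and all conditions common to both pairs persist. Moving the vertices of \<open>\<sigma>\<close> to
  the level one at a time produces a strong witness.
\<close>

definition lift_height :: "'a::real_inner \<Rightarrow> 'a \<Rightarrow> real"
  where "lift_height a x = a \<bullet> a - 2 * (x \<bullet> a)"

lemma norm_diff_sq_lift_height: "(norm (x - a))\<^sup>2 = x \<bullet> x + lift_height a x"
  by (simp add: lift_height_def power2_norm_eq_inner inner_diff inner_commute)

lemma norm_diff_le_iff_lift_height:
  "norm (x - a) \<le> norm (x - b) \<longleftrightarrow> lift_height a x \<le> lift_height b x"
proof -
  have "norm (x - a) \<le> norm (x - b) \<longleftrightarrow> (norm (x - a))\<^sup>2 \<le> (norm (x - b))\<^sup>2"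
    by simp
  then show ?thesis
    by (simp only: norm_diff_sq_lift_height add_le_cancel_left)
qed

lemma lift_height_affine:
  assumes "u + v = 1"
  shows "lift_height a (u *\<^sub>R x + v *\<^sub>R y) - (u * s + v * t)
    = u * (lift_height a x - s) + v * (lift_height a y - t)"
proof -
  have v: "v = 1 - u" using assms by simp
  show ?thesis
    unfolding v by (simp add: lift_height_def algebra_simps)
qed

text \<open>\<open>Q\<close> collects the vertices already moved to the level. With \<open>Q\<close>
  empty, \<open>x\<close> is a weak witness for \<open>P\<close>; with \<open>P\<close> empty and
  \<open>Q\<close> all of a simplex, \<open>x\<close> is a strong one. Keeping \<open>s\<close> free
  makes every condition linear in the pair of \<open>x\<close> and \<open>s\<close>.\<close>

definition level_witness :: "'a::real_inner set \<Rightarrow> 'a set \<Rightarrow> 'a set \<Rightarrow> 'a \<Rightarrow> real \<Rightarrow> bool"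
  where "level_witness A P Q x s \<longleftrightarrow>
    (\<forall>a\<in>P. lift_height a x \<le> s) \<and> (\<forall>a\<in>Q. lift_height a x = s) \<and>
    (\<forall>b\<in>A - (P \<union> Q). s \<le> lift_height b x)"

lemma weak_witness_imp_level_witness:
  assumes "finite P" "P \<noteq> {}" "weak_witness A P x"
  shows "\<exists>s. level_witness A P {} x s"
proof -
  have "level_witness A P {} x (Max ((\<lambda>a. lift_height a x) ` P))"
    using assms
    by (auto simp: level_witness_def weak_witness_def norm_diff_le_iff_lift_height)
  then show ?thesis ..
qed

text \<open>The level \<open>- (x \<bullet> x)\<close> corresponds to distance zero.\<close>

lemma level_witness_empty: "level_witness A {} {} x (- (x \<bullet> x))"
proof -
  have "- (x \<bullet> x) \<le> lift_height b x" for b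
    using norm_diff_sq_lift_height[of x b] zero_le_power2[of "norm (x - b)"] by linarith
  then show ?thesis
    by (simp add: level_witness_def)
qed

text \<open>Only \<open>q\<close> changes sides: in \<open>above\<close> it belongs to the rest of
  \<open>A\<close>, hence lies at or above the level. All other points satisfy the same condition
  for both pairs, and this condition is convex.\<close>

lemma level_witness_exchange:
  assumes below: "level_witness A (insert q P) Q x s"
    and above: "level_witness A P Q y t"
    and q: "q \<in> A" "q \<notin> P" "q \<notin> Q"
  shows "\<exists>z r. level_witness A P (insert q Q) z r"
proof -
  define d e where "d = lift_height q x - s" and "e = lift_height q y - t"
  have "d \<le> 0" "0 \<le> e"
    using below above q by (auto simp: level_witness_def d_def e_def)
  \<comment> \<open>The weights locate the zero of the affine function running from \<open>d\<close>
    to \<open>e\<close>. If \<open>d = e\<close>, both vanish and any weights would do; this case is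
    split off to avoid dividing by zero.\<close>
  obtain u v :: real where uv: "0 \<le> u" "0 \<le> v" "u + v = 1" "u * d + v * e = 0"
  proof (cases "d = e")
    case True
    then have "d = 0" using \<open>d \<le> 0\<close> \<open>0 \<le> e\<close> by simp
    then show ?thesis using that[of 1 0] by simp
  next
    case False
    then have "d < e" using \<open>d \<le> 0\<close> \<open>0 \<le> e\<close> by simp
    then show ?thesis
      using that[of "e / (e - d)" "- d / (e - d)"] \<open>d \<le> 0\<close> \<open>0 \<le> e\<close>
      by (simp add: divide_simps)
  qed
  define z where "z = u *\<^sub>R x + v *\<^sub>R y"
  define r where "r = u * s + v * t"
  have gap: "lift_height a z - r = u * (lift_height a x - s) + v * (lift_height a y - t)" for a
    unfolding z_def r_def by (rule lift_height_affine[OF uv(3)])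
  have "lift_height a z \<le> r" if "a \<in> P" for a
  proof -
    have "lift_height a x - s \<le> 0" "lift_height a y - t \<le> 0"
      using that below above by (simp_all add: level_witness_def)
    then have "u * (lift_height a x - s) \<le> 0" "v * (lift_height a y - t) \<le> 0"
      using uv(1,2) by (simp_all only: mult_nonneg_nonpos)
    then show ?thesis using gap[of a] by linarith
  qed
  moreover have "lift_height a z = r" if "a \<in> insert q Q" for a
  proof (cases "a = q")
    case True
    then show ?thesis using gap[of q] uv(4) by (simp add: d_def e_def)
  next
    case False
    then show ?thesis using that gap[of a] below above by (simp add: level_witness_def)
  qed
  moreover have "r \<le> lift_height b z" if "b \<in> A - (P \<union> insert q Q)" for b
  proof -
    have "0 \<le> lift_height b x - s" "0 \<le> lift_height b y - t"
      using that below above by (simp_all add: level_witness_def)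
    then have "0 \<le> u * (lift_height b x - s)" "0 \<le> v * (lift_height b y - t)"
      using uv(1,2) by (simp_all only: mult_nonneg_nonneg)
    then show ?thesis using gap[of b] by linarith
  qed
  ultimately have "level_witness A P (insert q Q) z r"
    by (simp add: level_witness_def)
  then show ?thesis by blast
qed

text \<open>Induction on \<open>Q\<close> with \<open>P\<close> general, since adding
  \<open>q\<close> to \<open>Q\<close> uses the hypothesis twice: once with \<open>q\<close> added
  to \<open>P\<close>, once with \<open>P\<close> itself.\<close>

lemma exists_level_witness:
  assumes weak: "\<And>P. P \<subseteq> \<sigma> \<Longrightarrow> P \<noteq> {} \<Longrightarrow> \<exists>x. weak_witness A P x"
    and "finite \<sigma>" "\<sigma> \<subseteq> A" "finite Q" "Q \<subseteq> \<sigma>" "P \<subseteq> \<sigma> - Q"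
  shows "\<exists>x s. level_witness A P Q x s"
  using \<open>finite Q\<close> \<open>Q \<subseteq> \<sigma>\<close> \<open>P \<subseteq> \<sigma> - Q\<close>
proof (induction Q arbitrary: P rule: finite_induct)
  case empty
  show ?case
  \<comment> \<open>The assumption \<open>weak\<close> says nothing about the empty set, so the
    level below all points serves there.\<close>
  proof (cases "P = {}")
    case True
    then show ?thesis using level_witness_empty by blast
  next
    case False
    have "finite P" using empty.prems(2) \<open>finite \<sigma>\<close> by (auto intro: finite_subset)
    moreover obtain x where "weak_witness A P x"
      using weak[of P] False empty.prems by blast
    ultimately show ?thesis
      using weak_witness_imp_level_witness[OF _ False] by blast
  qed
next
  case (insert q Q)
  obtain x s where "level_witness A (insert q P) Q x s"
    using insert.IH[of "insert q P"] insert.prems insert.hyps by blast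
  moreover obtain y t where "level_witness A P Q y t"
    using insert.IH[of P] insert.prems by blast
  moreover have "q \<in> A" "q \<notin> P" "q \<notin> Q"
    using insert.prems insert.hyps \<open>\<sigma> \<subseteq> A\<close> by auto
  ultimately show ?case
    by (rule level_witness_exchange)
qed

lemma level_witness_imp_strong_witness:
  assumes "level_witness A {} \<sigma> x s"
  shows "strong_witness A \<sigma> x"
proof -
  \<comment> \<open>Letting \<open>b\<close> range over \<open>\<sigma>\<close> too allows swapping
    \<open>a\<close> and \<open>b\<close> there, so antisymmetry gives the equal distances.\<close>
  have "norm (x - a) \<le> norm (x - b)" if "a \<in> \<sigma>" "b \<in> A \<union> \<sigma>" for a b
  proof -
    have "lift_height a x \<le> lift_height b x"
      using assms that by (cases "b \<in> \<sigma>") (simp_all add: level_witness_def)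
    then show ?thesis
      by (simp only: norm_diff_le_iff_lift_height)
  qed
  then show ?thesis
    unfolding strong_witness_def weak_witness_def by (meson DiffD1 UnCI order_antisym)
qed

lemma strong_witness_imp_weak_witness_subset:
  assumes "strong_witness A \<sigma> x" "\<tau> \<subseteq> \<sigma>"
  shows "weak_witness A \<tau> x"
  unfolding weak_witness_def
proof (intro ballI)
  fix a b assume "a \<in> \<tau>" "b \<in> A - \<tau>"
  then have "a \<in> \<sigma>" "b \<in> A" using assms(2) by auto
  show "norm (x - a) \<le> norm (x - b)"
  proof (cases "b \<in> \<sigma>")
    case True
    then have "norm (x - a) = norm (x - b)"
      using assms(1) \<open>a \<in> \<sigma>\<close> unfolding strong_witness_def by blast
    then show ?thesis by simp
  next
    case False
    then show ?thesis
      using assms(1) \<open>a \<in> \<sigma>\<close> \<open>b \<in> A\<close> unfolding strong_witness_def weak_witness_def by blast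
  qed
qed

theorem theorem1:
  fixes A \<sigma> :: "(real ^ 'n) set" and p :: nat
  assumes "abstract_simplex A p \<sigma>"
  shows "(\<exists>x. strong_witness A \<sigma> x) \<longleftrightarrow>
    (\<forall>\<tau>. subsimplex \<tau> \<sigma> \<longrightarrow> (\<exists>x. weak_witness A \<tau> x))"
proof
  assume "\<exists>x. strong_witness A \<sigma> x"
  then show "\<forall>\<tau>. subsimplex \<tau> \<sigma> \<longrightarrow> (\<exists>x. weak_witness A \<tau> x)"
    unfolding subsimplex_def using strong_witness_imp_weak_witness_subset by blast
next
  assume weak: "\<forall>\<tau>. subsimplex \<tau> \<sigma> \<longrightarrow> (\<exists>x. weak_witness A \<tau> x)"
  have "finite \<sigma>" "\<sigma> \<subseteq> A"
    using assms by (auto simp: abstract_simplex_def)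
  moreover have "\<exists>x. weak_witness A P x" if "P \<subseteq> \<sigma>" "P \<noteq> {}" for P
    using weak that by (simp add: subsimplex_def)
  \<comment> \<open>Taking \<open>Q\<close> to be all of \<open>\<sigma>\<close> forces
    \<open>P\<close> to be empty.\<close>
  ultimately obtain x s where "level_witness A {} \<sigma> x s"
    using exists_level_witness[of \<sigma> A \<sigma> "{}"] by blast
  then show "\<exists>x. strong_witness A \<sigma> x"
    using level_witness_imp_strong_witness by blast
qed

end
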